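(* Let $(X,\|\cdot\|)$ be a Banach space. If there exists $t_0\in(0,1)$ such that $\bar{\beta}_{\|\cdot\|}(t_0)>0$, then $X$ admits an equivalent norm that is asymptotically uniformly smooth.
   Context: For a Banach space $(X,\|\cdot\|)$, the asymptotic $(\beta)$-modulus $\bar{\beta}_{\|\cdot\|}\colon[0,1]\to[0,\infty]$ is defined by $$\bar{\beta}_{\|\cdot\|}(t)=\inf\Big\{\sup_{n\in\mathbb N}\Big\{1-\Big\|\frac{x+y_n}{2}\Big\|\Big\}\colon x\in X,\ (y_n)_{n\in\mathbb N}\subset X,\ \max\{\|x\|,\sup_{n\in\mathbb N}\|y_n\|\}\le 1,\ \inf_{n\neq m}\|y_m-y_n\|\ge t\Big\},$$ with the convention $\inf\emptyset=+\infty$. Let $\mathrm{cof}(X)$ be the set of all closed finite-codimensional subspaces of $X$. The modulus of asymptotic uniform smoothness of a norm $\|\cdot\|$ on $X$ is defined for $t\ge 0$ by $$\bar{\rho}_{\|\cdot\|}(t)=\sup_{x\in X,\ \|x\|=1}\ \inf_{Y\in\mathrm{cof}(X)}\ \sup_{y\in Y,\ \|y\|=1}\|x+ty\|-1.$$ The norm is asymptotically uniformly smooth if $\lim_{t\to0}\bar{\rho}_{\|\cdot\|}(t)/t=0$. Finite-dimensional spaces are regarded as (trivially) asymptotically uniformly smooth. *)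

theory Defs
  imports "HOL-Analysis.Analysis"
begin

text \<open>Nonnegativity is not listed below since it follows from the other three properties.\<close>

definition is_norm :: "('a::real_vector \<Rightarrow> real) \<Rightarrow> bool" where
  "is_norm N \<longleftrightarrow>
     (\<forall>x. N x = 0 \<longleftrightarrow> x = 0) \<and>
     (\<forall>x y. N (x + y) \<le> N x + N y) \<and>
     (\<forall>c x. N (c *\<^sub>R x) = \<bar>c\<bar> * N x)"

definition equivalent_norm :: "('a::real_normed_vector \<Rightarrow> real) \<Rightarrow> bool" where
  "equivalent_norm N \<longleftrightarrow>
     is_norm N \<and> (\<exists>c>0. \<exists>C>0. \<forall>x. c * norm x \<le> N x \<and> N x \<le> C * norm x)"

text \<open>
  The moduli take a norm \<open>N\<close> as an argument because they are used both for the given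
  norm and for a renorming.  They are valued in \<^typ>\<open>ereal\<close>, where the infimum of
  the empty set is \<open>\<infinity>\<close>.
\<close>

definition beta_modulus :: "('a::real_vector \<Rightarrow> real) \<Rightarrow> real \<Rightarrow> ereal" where
  "beta_modulus N t =
     (INF (x, y) \<in> {(x, y :: nat \<Rightarrow> 'a).
          N x \<le> 1 \<and> (\<forall>n. N (y n) \<le> 1) \<and> (\<forall>m n. m \<noteq> n \<longrightarrow> t \<le> N (y m - y n))}.
        SUP n. ereal (1 - N ((1/2) *\<^sub>R (x + y n))))"

text \<open>
  Finite codimension: the quotient by \<open>Y\<close> is spanned by the classes of finitely many
  vectors.  Closedness refers to the topology of the type, which is also the topology of
  every equivalent norm.
\<close>

definition cof :: "'a::real_normed_vector set set" where
  "cof = {Y. subspace Y \<and> closed Y \<and> (\<exists>F. finite F \<and> span (Y \<union> F) = UNIV)}"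

definition aus_modulus :: "('a::real_normed_vector \<Rightarrow> real) \<Rightarrow> real \<Rightarrow> ereal" where
  "aus_modulus N t =
     (SUP x \<in> {x. N x = 1}. INF Y \<in> cof. SUP y \<in> {y \<in> Y. N y = 1}.
        ereal (N (x + t *\<^sub>R y) - 1))"

text \<open>
  In finite dimension \<^term>\<open>{0}\<close> belongs to \<^const>\<open>cof\<close>, so the innermost supremum ranges
  over the empty set and the modulus is \<open>-\<infinity>\<close>; hence the separate clause for
  finite-dimensional spaces, which are asymptotically uniformly smooth by convention.
\<close>

definition asymp_uniformly_smooth :: "('a::real_normed_vector \<Rightarrow> real) \<Rightarrow> bool" where
  "asymp_uniformly_smooth N \<longleftrightarrow>
     (\<exists>F::'a set. finite F \<and> span F = UNIV) \<or>
     ((\<lambda>t. aus_modulus N t / ereal t) \<longlongrightarrow> 0) (at_right 0)"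

end

theory Submission imports Defs begin

text \<open>
  If \<open>x\<close> is in the unit ball and every finite-codimensional subspace contained a unit ball vector
  \<open>y\<close> with \<open>x + y\<close> of norm close to 2, then successive choices in kernels of norming functionals
  would give a separated sequence contradicting the hypothesis on the modulus.  Hence for some
  \<open>l < 2\<close> every such \<open>x\<close> satisfies \<open>norm (x + y) \<le> l\<close> for all \<open>y\<close> in the unit ball of some
  finite-codimensional subspace.  Merging vectors pairwise, this improves to an asymptotic bound for
  sums of \<open>n\<close> vectors by a power of \<open>n\<close> with exponent less than 1.  Positions reachable by adding
  such vectors, each paired with the price paid, with price \<open>o(norm y)\<close> for small
  moves \<open>y\<close>, therefore have norm at most the price plus a constant.  Having a
  finite-codimensional subspace of cheap next moves survives convex combinations, so the positions
  of price at most 1 in the convex hull form, after symmetrization, the unit ball of an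
  asymptotically uniformly smooth norm.
\<close>

section \<open>Finite-codimensional subspaces\<close>

text \<open>Induction on the generators: moving \<open>f\<close> into
  \<open>W = span (insert f V)\<close> leaves one generator fewer to supplement \<open>W\<close>.
  Since \<open>V\<close> has codimension at most one in \<open>W\<close>, so has
  \<open>U \<inter> V\<close> in \<open>U \<inter> W\<close>, and a single extra vector
  \<open>z\<close> leads back from \<open>W\<close> to \<open>V\<close>.\<close>

lemma subspace_codim_Int:
  fixes U V :: "'a::real_vector set"
  assumes "finite F" "subspace U" "subspace V" "span (V \<union> F) = UNIV"
  shows "\<exists>G. finite G \<and> U \<subseteq> span ((U \<inter> V) \<union> G)"
  using assms
proof (induction F arbitrary: V rule: finite_induct)
  case empty
  then have "V = UNIV" using span_eq_iff[of V] by simp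
  then have "U \<subseteq> span ((U \<inter> V) \<union> {})" using span_superset[of U] by auto
  then show ?case by blast
next
  case (insert f F)
  define W where "W = span (insert f V)"
  have W_sub: "subspace W" by (simp add: W_def)
  have "insert f V \<subseteq> W" unfolding W_def by (rule span_superset)
  then have "V \<union> insert f F \<subseteq> W \<union> F" by blast
  from span_mono[OF this] have "span (W \<union> F) = UNIV" using insert.prems(3) by auto
  with insert.IH[OF insert.prems(1) W_sub] obtain G where
    G: "finite G" "U \<subseteq> span ((U \<inter> W) \<union> G)" by blast
  have W: "\<exists>a. w - a *\<^sub>R f \<in> V" if "w \<in> W" for w
  proof -
    have "span V = V" using insert.prems(2) by simp
    then show ?thesis using that span_breakdown_eq[of w f V] unfolding W_def by metis
  qed
  have "\<exists>z. U \<inter> W \<subseteq> span (insert z (U \<inter> V))"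
  proof (cases "U \<inter> W \<subseteq> V")
    case True
    then have "U \<inter> W \<subseteq> insert 0 (U \<inter> V)" by blast
    then show ?thesis using order_trans[OF _ span_superset] by blast
  next
    case False
    then obtain z where z: "z \<in> U" "z \<in> W" "z \<notin> V" by blast
    obtain b where b: "z - b *\<^sub>R f \<in> V" using W[OF z(2)] by blast
    have b0: "b \<noteq> 0" using b z by auto
    have "w \<in> span (insert z (U \<inter> V))" if w: "w \<in> U" "w \<in> W" for w
    proof -
      obtain a where a: "w - a *\<^sub>R f \<in> V" using W[OF w(2)] by blast
      have "(w - a *\<^sub>R f) - (a / b) *\<^sub>R (z - b *\<^sub>R f) \<in> V"
        using subspace_diff[OF insert.prems(2) a subspace_scale[OF insert.prems(2) b]] .
      also have "(w - a *\<^sub>R f) - (a / b) *\<^sub>R (z - b *\<^sub>R f) = w - (a / b) *\<^sub>R z"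
        using b0 by (simp add: scaleR_diff_right)
      finally have "w - (a / b) *\<^sub>R z \<in> U \<inter> V"
        using w z insert.prems(1) by (simp add: subspace_diff subspace_scale)
      from span_base[OF this] show ?thesis
        unfolding span_breakdown_eq by (rule exI)
    qed
    then show ?thesis by blast
  qed
  then obtain z where z: "U \<inter> W \<subseteq> span (insert z (U \<inter> V))" by blast
  have "span (insert z (U \<inter> V)) \<subseteq> span ((U \<inter> V) \<union> insert z G)"
    by (rule span_mono) blast
  moreover have "G \<subseteq> span ((U \<inter> V) \<union> insert z G)"
    using span_superset[of "(U \<inter> V) \<union> insert z G"] by simp
  ultimately have "(U \<inter> W) \<union> G \<subseteq> span ((U \<inter> V) \<union> insert z G)"
    using z by simp
  then have "span ((U \<inter> W) \<union> G) \<subseteq> span ((U \<inter> V) \<union> insert z G)"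
    by (rule span_minimal[OF _ subspace_span])
  with G show ?case by (meson finite_insert order_trans)
qed

lemma subspace_closure:
  fixes S :: "'a::real_normed_vector set"
  assumes "subspace S"
  shows "subspace (closure S)"
  unfolding subspace_def
proof (intro conjI ballI allI)
  show "0 \<in> closure S" using assms closure_subset subspace_0 by blast
next
  fix x y assume "x \<in> closure S" "y \<in> closure S"
  then obtain f g where "\<forall>n. f n \<in> S" "f \<longlonglongrightarrow> x" "\<forall>n. g n \<in> S" "g \<longlonglongrightarrow> y"
    by (auto simp: closure_sequential)
  then show "x + y \<in> closure S"
    unfolding closure_sequential using assms
    by (intro exI[of _ "\<lambda>n. f n + g n"]) (auto intro: subspace_add tendsto_add)
next
  fix c x assume "x \<in> closure S"
  then obtain f where "\<forall>n. f n \<in> S" "f \<longlonglongrightarrow> x"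
    by (auto simp: closure_sequential)
  then show "c *\<^sub>R x \<in> closure S"
    unfolding closure_sequential using assms
    by (intro exI[of _ "\<lambda>n. c *\<^sub>R f n"]) (auto intro: subspace_scale tendsto_intros)
qed

lemma cof_subspace: "Y \<in> cof \<Longrightarrow> subspace Y"
  by (simp add: cof_def)

lemma cof_UNIV: "UNIV \<in> cof"
  unfolding cof_def by (intro CollectI conjI exI[of _ "{}"]) simp_all

lemma cof_Int:
  assumes "Y \<in> cof" "Z \<in> cof"
  shows "Y \<inter> Z \<in> cof"
proof -
  from assms obtain F F' where F: "finite F" "span (Y \<union> F) = UNIV"
    and F': "finite F'" "span (Z \<union> F') = UNIV" by (auto simp: cof_def)
  obtain G where G: "finite G" "Y \<subseteq> span ((Y \<inter> Z) \<union> G)"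
    using subspace_codim_Int[OF F'(1) _ _ F'(2)] assms cof_subspace by blast
  have "span ((Y \<inter> Z) \<union> G) \<subseteq> span ((Y \<inter> Z) \<union> (G \<union> F))"
    by (rule span_mono) blast
  moreover have "F \<subseteq> span ((Y \<inter> Z) \<union> (G \<union> F))"
    using span_superset[of "(Y \<inter> Z) \<union> (G \<union> F)"] by simp
  ultimately have "Y \<union> F \<subseteq> span ((Y \<inter> Z) \<union> (G \<union> F))" using G by simp
  then have "span (Y \<union> F) \<subseteq> span ((Y \<inter> Z) \<union> (G \<union> F))"
    by (rule span_minimal[OF _ subspace_span])
  then have "span ((Y \<inter> Z) \<union> (G \<union> F)) = UNIV" using F by auto
  moreover have "subspace (Y \<inter> Z)" "closed (Y \<inter> Z)"
    using assms by (simp_all add: cof_def subspace_inter closed_Int)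
  ultimately show ?thesis
    unfolding cof_def using F(1) G(1) by (intro CollectI conjI exI[of _ "G \<union> F"]) auto
qed

lemma cof_INT:
  assumes "finite I" "\<And>i. i \<in> I \<Longrightarrow> Y i \<in> cof"
  shows "(\<Inter>i\<in>I. Y i) \<in> cof"
  using assms by (induction I rule: finite_induct) (simp_all add: cof_UNIV cof_Int)

section \<open>Norm orthogonality and one-dimensional extensions\<close>

text \<open>This is the extension step of Hahn--Banach, written with kernels. The hypothesis says
  that the functional with kernel \<open>Y\<close> and value 1 at \<open>x\<close> has norm at most
  \<open>1 / norm x\<close>. If \<open>c\<close> is the value at \<open>z\<close> of an extension
  with the same bound, then \<open>z - c *\<^sub>R x\<close> joins the kernel.\<close>

lemma orthogonal_subspace_extend:
  fixes x z :: "'a::real_normed_vector"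
  assumes Y: "subspace Y" and orth: "\<And>y. y \<in> Y \<Longrightarrow> norm x \<le> norm (x + y)"
    and x: "x \<noteq> 0"
  shows "\<exists>c. \<forall>y\<in>span (insert (z - c *\<^sub>R x) Y). norm x \<le> norm (x + y)"
proof -
  have orth': "a * norm x \<le> norm (a *\<^sub>R x + y)" if y: "y \<in> Y" for a y
  proof (cases "a > 0")
    case True
    have "norm x \<le> norm (x + (1/a) *\<^sub>R y)"
      by (rule orth) (simp add: Y y subspace_scale)
    then have "a * norm x \<le> a * norm (x + (1/a) *\<^sub>R y)"
      using True by simp
    also have "\<dots> = norm (a *\<^sub>R (x + (1/a) *\<^sub>R y))" using True by simp
    finally show ?thesis using True by (simp add: scaleR_add_right)
  next
    case False
    then have "a * norm x \<le> 0" by (simp add: mult_nonpos_nonneg)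
    then show ?thesis using norm_ge_zero order_trans by blast
  qed
  \<comment> \<open>The elements of \<open>U\<close> and \<open>L\<close> are the upper and lower
    bounds that \<open>\<bar>b + c\<bar> * norm x \<le> norm (b *\<^sub>R x + y + z)\<close> imposes
    on \<open>c\<close>, over all \<open>b\<close> and all \<open>y \<in> Y\<close>.\<close>
  define U where "U = {norm (b *\<^sub>R x + y + z) / norm x - b | b y. y \<in> Y}"
  define L where "L = {- (norm (b *\<^sub>R x + y + z) / norm x) - b | b y. y \<in> Y}"
  have nx: "norm x > 0" using x by simp
  have LU: "l \<le> u" if lu: "l \<in> L" "u \<in> U" for l u
  proof -
    obtain b y where l: "y \<in> Y" "l = - (norm (b *\<^sub>R x + y + z) / norm x) - b"
      using lu unfolding L_def by blast
    obtain b' y' where u: "y' \<in> Y" "u = norm (b' *\<^sub>R x + y' + z) / norm x - b'"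
      using lu unfolding U_def by blast
    have "(b' - b) * norm x \<le> norm ((b' - b) *\<^sub>R x + (y' - y))"
      using orth' l u Y by (simp add: subspace_diff)
    also have "(b' - b) *\<^sub>R x + (y' - y) = (b' *\<^sub>R x + y' + z) - (b *\<^sub>R x + y + z)"
      by (simp add: algebra_simps)
    also have "norm \<dots> \<le> norm (b' *\<^sub>R x + y' + z) + norm (b *\<^sub>R x + y + z)"
      by (rule norm_triangle_ineq4)
    finally have "b' - b \<le> (norm (b' *\<^sub>R x + y' + z) + norm (b *\<^sub>R x + y + z)) / norm x"
      using nx by (simp add: pos_le_divide_eq)
    then show ?thesis by (simp add: l u add_divide_distrib)
  qed
  have "L \<noteq> {}" "U \<noteq> {}" unfolding L_def U_def using Y subspace_0 by blast+
  define c where "c = Sup L"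
  have cL: "l \<le> c" if "l \<in> L" for l
  proof -
    obtain u where "u \<in> U" using \<open>U \<noteq> {}\<close> by blast
    then have "bdd_above L" using LU by (intro bdd_aboveI[of _ u])
    then show ?thesis unfolding c_def by (rule cSup_upper[OF that])
  qed
  have cU: "c \<le> u" if "u \<in> U" for u
    unfolding c_def using that LU \<open>L \<noteq> {}\<close> by (intro cSup_least) auto
  have key: "\<bar>b + c\<bar> * norm x \<le> norm (b *\<^sub>R x + y + z)" if "y \<in> Y" for b y
  proof -
    have "norm (b *\<^sub>R x + y + z) / norm x - b \<in> U" unfolding U_def using that by blast
    from cU[OF this] have 1: "b + c \<le> norm (b *\<^sub>R x + y + z) / norm x" by simp
    have "- (norm (b *\<^sub>R x + y + z) / norm x) - b \<in> L" unfolding L_def using that by blast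
    from cL[OF this] have 2: "- (b + c) \<le> norm (b *\<^sub>R x + y + z) / norm x" by simp
    from 1 2 have "\<bar>b + c\<bar> \<le> norm (b *\<^sub>R x + y + z) / norm x" by linarith
    then show ?thesis using nx by (simp add: pos_le_divide_eq)
  qed
  have "norm x \<le> norm (x + v)" if v: "v \<in> span (insert (z - c *\<^sub>R x) Y)" for v
  proof -
    obtain s where "v - s *\<^sub>R (z - c *\<^sub>R x) \<in> Y"
      using v Y span_breakdown_eq[of v _ Y] by (metis span_eq_iff)
    then obtain y where y: "y \<in> Y" "v = y + s *\<^sub>R (z - c *\<^sub>R x)"
      by (metis diff_add_cancel)
    show ?thesis
    proof (cases "s = 0")
      case True
      then show ?thesis using y orth by simp
    next
      case False
      \<comment> \<open>The coefficients are those for which \<open>s\<close> times the vector on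
        the right is \<open>x + v\<close>.\<close>
      have "\<bar>(1/s - c) + c\<bar> * norm x \<le> norm ((1/s - c) *\<^sub>R x + (1/s) *\<^sub>R y + z)"
        using y Y by (intro key) (simp add: subspace_scale)
      then have "\<bar>s\<bar> * (\<bar>1/s\<bar> * norm x) \<le> \<bar>s\<bar> * norm ((1/s - c) *\<^sub>R x + (1/s) *\<^sub>R y + z)"
        by (intro mult_left_mono) auto
      also have "\<dots> = norm (s *\<^sub>R ((1/s - c) *\<^sub>R x + (1/s) *\<^sub>R y + z))" by simp
      also have "s *\<^sub>R ((1/s - c) *\<^sub>R x + (1/s) *\<^sub>R y + z) = x + v"
        using False y by (simp add: algebra_simps)
      finally show ?thesis using False by simp
    qed
  qed
  then show ?thesis by blast
qed

text \<open>A form of the Hahn--Banach theorem: the subspace is the kernel of a norming functional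
  of \<open>x\<close>.\<close>

lemma exists_orthogonal_cof:
  fixes x :: "'a::real_normed_vector"
  shows "\<exists>Y\<in>cof. \<forall>y\<in>Y. norm x \<le> norm (x + y)"
proof (cases "x = 0")
  case True
  then show ?thesis using cof_UNIV by auto
next
  case False
  define A where "A = {Y. subspace Y \<and> (\<forall>y\<in>Y. norm x \<le> norm (x + y))}"
  have "\<exists>M\<in>A. \<forall>X\<in>A. M \<subseteq> X \<longrightarrow> X = M"
  proof (rule subset_Zorn_nonempty)
    have "{0} \<in> A" by (simp add: A_def)
    then show "A \<noteq> {}" by blast
    fix \<C> assume ne: "\<C> \<noteq> {}" and ch: "subset.chain A \<C>"
    have sub: "subspace Y" if "Y \<in> \<C>" for Y
      using ch that by (auto simp: subset_chain_def A_def)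
    have "subspace (\<Union>\<C>)"
      unfolding subspace_def
    proof (intro conjI ballI allI)
      show "0 \<in> \<Union>\<C>" using ne sub subspace_0 by blast
    next
      fix u v assume "u \<in> \<Union>\<C>" "v \<in> \<Union>\<C>"
      then obtain P Q where PQ: "P \<in> \<C>" "Q \<in> \<C>" "u \<in> P" "v \<in> Q" by blast
      then have "P \<subseteq> Q \<or> Q \<subseteq> P" using ch by (auto simp: subset_chain_def)
      then show "u + v \<in> \<Union>\<C>" using PQ sub subspace_add by blast
    next
      fix a u assume "u \<in> \<Union>\<C>"
      then show "a *\<^sub>R u \<in> \<Union>\<C>" using sub subspace_scale by blast
    qed
    moreover have "\<forall>y\<in>\<Union>\<C>. norm x \<le> norm (x + y)"
      using ch by (auto simp: subset_chain_def A_def)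
    ultimately show "\<Union>\<C> \<in> A" by (simp add: A_def)
  qed
  then obtain M where M: "subspace M" "\<And>y. y \<in> M \<Longrightarrow> norm x \<le> norm (x + y)"
    and max: "\<And>X. X \<in> A \<Longrightarrow> M \<subseteq> X \<Longrightarrow> X = M" by (auto simp: A_def)
  have spn: "z \<in> span (insert x M)" for z
  proof -
    obtain c where c: "\<forall>y\<in>span (insert (z - c *\<^sub>R x) M). norm x \<le> norm (x + y)"
      using orthogonal_subspace_extend[OF M False] by blast
    then have "span (insert (z - c *\<^sub>R x) M) \<in> A" by (simp add: A_def)
    from max[OF this] have "z - c *\<^sub>R x \<in> M"
      using span_superset[of "insert (z - c *\<^sub>R x) M"] by blast
    then show ?thesis unfolding span_breakdown_eq using span_base by blast
  qed
  \<comment> \<open>Closedness also comes from maximality, because the norm inequality passes to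
    limits.\<close>
  have "closure M \<in> A"
  proof -
    have "closed {y. norm x \<le> norm (x + y)}"
      by (intro closed_Collect_le continuous_intros)
    then have "closure M \<subseteq> {y. norm x \<le> norm (x + y)}"
      using M by (intro closure_minimal) auto
    then show ?thesis using M by (auto simp: A_def intro: subspace_closure)
  qed
  from max[OF this] have "closed M"
    using closure_subset closure_eq by blast
  then have "M \<in> cof"
    using spn M unfolding cof_def by (auto intro!: exI[of _ "{x}"])
  then show ?thesis using M by blast
qed

section \<open>Separated sequences and the asymptotic modulus\<close>

text \<open>Each term is chosen in the orthogonal subspaces of all earlier terms. For
  \<open>m < n\<close> the vector \<open>- y n\<close> then lies in \<open>H (y m)\<close>, so
  subtracting \<open>y n\<close> from \<open>y m\<close> cannot decrease the norm below
  \<open>norm (y m) \<ge> t\<close>.\<close>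

lemma separated_sequence:
  fixes P :: "'a::real_normed_vector \<Rightarrow> bool"
  assumes P: "\<And>Y. Y \<in> cof \<Longrightarrow> \<exists>y\<in>Y. P y"
    and t: "\<And>y. P y \<Longrightarrow> t \<le> norm y"
  shows "\<exists>y :: nat \<Rightarrow> 'a. (\<forall>n. P (y n)) \<and> (\<forall>m n. m \<noteq> n \<longrightarrow> t \<le> norm (y m - y n))"
proof -
  obtain H :: "'a \<Rightarrow> 'a set" where
    H: "\<And>x. H x \<in> cof" "\<And>x y. y \<in> H x \<Longrightarrow> norm x \<le> norm (x + y)"
    using exists_orthogonal_cof by metis
  have "\<exists>y :: nat \<Rightarrow> 'a. \<forall>n. P (y n) \<and> (\<forall>m<n. y n \<in> H (y m))"
  proof (rule dependent_wellorder_choice)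
    fix n :: nat and f :: "nat \<Rightarrow> 'a"
    have "(\<Inter>m\<in>{..<n}. H (f m)) \<in> cof" by (intro cof_INT H) auto
    from P[OF this] show "\<exists>r. P r \<and> (\<forall>m<n. r \<in> H (f m))" by auto
  qed auto
  then obtain y :: "nat \<Rightarrow> 'a" where
    y: "\<And>n. P (y n)" "\<And>m n. m < n \<Longrightarrow> y n \<in> H (y m)" by blast
  have lt: "t \<le> norm (y m - y n)" if "m < n" for m n
  proof -
    have "- y n \<in> H (y m)"
      using y(2)[OF that] cof_subspace[OF H(1)] by (simp add: subspace_neg)
    from H(2)[OF this] show ?thesis using t[OF y(1)[of m]] by simp
  qed
  have "t \<le> norm (y m - y n)" if "m \<noteq> n" for m n
    using that lt[of m n] lt[of n m] by (cases "m < n") (auto simp: norm_minus_commute)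
  then show ?thesis using y by blast
qed

lemma beta_modulus_imp_asymptotic_bound:
  assumes "t < 1" "0 < beta_modulus (norm :: 'a::real_normed_vector \<Rightarrow> real) t"
  shows "\<exists>l. 1 \<le> l \<and> l < 2 \<and>
    (\<forall>x::'a. norm x \<le> 1 \<longrightarrow> (\<exists>Y\<in>cof. \<forall>y\<in>Y. norm y \<le> 1 \<longrightarrow> norm (x + y) \<le> l))"
proof -
  let ?\<beta> = "beta_modulus (norm :: 'a \<Rightarrow> real) t"
  obtain b where b: "0 < ereal b" "ereal b < ?\<beta>" using ereal_dense2[OF assms(2)] by blast
  \<comment> \<open>Each bound has its use: \<open>\<eta> \<le> 1 - t\<close> makes every bad
    \<open>y\<close> have norm at least \<open>t\<close>, which \<open>separated_sequence\<close>
    requires; \<open>\<eta> \<le> b\<close> keeps the supremum for a bad sequence at most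
    \<open>b\<close>; \<open>\<eta> \<le> 1\<close> gives \<open>1 \<le> l\<close> for
    \<open>l = 2 - \<eta>\<close>.\<close>
  define \<eta> where "\<eta> = min b (min 1 (1 - t))"
  have \<eta>: "0 < \<eta>" "\<eta> \<le> 1" "\<eta> \<le> b" "\<eta> \<le> 1 - t" using b assms by (auto simp: \<eta>_def)
  have "\<exists>Y\<in>cof. \<forall>y\<in>Y. norm y \<le> 1 \<longrightarrow> norm (x + y) \<le> 2 - \<eta>" if x: "norm x \<le> 1" for x :: 'a
  proof (rule ccontr)
    assume "\<not> ?thesis"
    then have *: "\<And>Y. Y \<in> cof \<Longrightarrow> \<exists>y\<in>Y. norm y \<le> 1 \<and> norm (x + y) > 2 - \<eta>"
      by (meson not_le)
    have **: "t \<le> norm y" if "norm y \<le> 1 \<and> norm (x + y) > 2 - \<eta>" for y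
      using that x \<eta> norm_triangle_ineq[of x y] by linarith
    obtain y :: "nat \<Rightarrow> 'a" where y: "\<And>n. norm (y n) \<le> 1" "\<And>n. norm (x + y n) > 2 - \<eta>"
      "\<And>m n. m \<noteq> n \<Longrightarrow> t \<le> norm (y m - y n)"
      using separated_sequence[OF * **] by blast
    have "?\<beta> \<le> (SUP n. ereal (1 - norm ((1/2) *\<^sub>R (x + y n))))"
      unfolding beta_modulus_def using x y by (intro INF_lower2[of "(x, y)"]) auto
    also have "\<dots> \<le> ereal b"
    proof (rule SUP_least)
      fix n
      have "1 - norm (x + y n) / 2 \<le> b" using y(2)[of n] \<eta> by (simp add: field_simps)
      then show "ereal (1 - norm ((1/2) *\<^sub>R (x + y n))) \<le> ereal b" by simp
    qed
    finally show False using b by simp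
  qed
  then show ?thesis using \<eta> by (intro exI[of _ "2 - \<eta>"]) auto
qed

section \<open>Equivalent norms from convex bodies\<close>

definition minkowski :: "'a::real_vector set \<Rightarrow> 'a \<Rightarrow> real" where
  "minkowski D x = Inf {s. 0 < s \<and> (1/s) *\<^sub>R x \<in> D}"

locale convex_body =
  fixes D :: "'a::real_normed_vector set" and R :: real
  assumes convex: "convex D"
    and sym: "x \<in> D \<Longrightarrow> - x \<in> D"
    and inner: "norm x \<le> 1 \<Longrightarrow> x \<in> D"
    and outer: "x \<in> D \<Longrightarrow> norm x \<le> R"
    and R_pos: "0 < R"
begin

lemma minkowski_le: "0 < s \<Longrightarrow> (1/s) *\<^sub>R x \<in> D \<Longrightarrow> minkowski D x \<le> s"
  unfolding minkowski_def by (rule cInf_lower) (auto intro: bdd_belowI[of _ 0])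

lemma minkowski_le_norm: "minkowski D x \<le> norm x"
proof (cases "x = 0")
  case True
  have "minkowski D x \<le> 0"
    by (rule field_le_epsilon) (use True inner in \<open>auto intro: minkowski_le\<close>)
  then show ?thesis using True by simp
next
  case False
  then show ?thesis by (intro minkowski_le inner) auto
qed

lemma minkowski_nonempty: "{s. 0 < s \<and> (1/s) *\<^sub>R x \<in> D} \<noteq> {}"
proof -
  have "norm x + 1 \<in> {s. 0 < s \<and> (1/s) *\<^sub>R x \<in> D}"
    using norm_ge_zero[of x] by (auto intro!: inner add_nonneg_pos simp: field_simps simp del: norm_ge_zero)
  then show ?thesis by blast
qed

lemma norm_le_minkowski: "norm x \<le> R * minkowski D x"
proof -
  have "norm x / R \<le> minkowski D x"
    unfolding minkowski_def
  proof (rule cInf_greatest[OF minkowski_nonempty], clarify)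
    fix s :: real assume s: "0 < s" "(1/s) *\<^sub>R x \<in> D"
    from outer[OF s(2)] s have "norm x \<le> R * s" by (simp add: field_simps)
    then show "norm x / R \<le> s" using R_pos by (simp add: field_simps)
  qed
  then show ?thesis using R_pos by (simp add: field_simps)
qed

lemma minkowski_nonneg: "0 \<le> minkowski D x"
  using norm_le_minkowski[of x] R_pos by (meson norm_ge_zero order_trans zero_le_mult_iff not_less)

text \<open>Some \<open>r < s\<close> already scales \<open>x\<close> into \<open>D\<close>, and
  shrinking towards \<open>0 \<in> D\<close> stays inside by convexity. The inequality is strict
  because \<open>D\<close> is not assumed closed.\<close>

lemma minkowski_less:
  assumes "minkowski D x < s"
  shows "(1/s) *\<^sub>R x \<in> D"
proof -
  obtain r where r: "0 < r" "(1/r) *\<^sub>R x \<in> D" "r < s"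
    using cInf_lessD[OF minkowski_nonempty] assms unfolding minkowski_def by blast
  have "(r/s) *\<^sub>R ((1/r) *\<^sub>R x) + (1 - r/s) *\<^sub>R 0 \<in> D"
    using r inner by (intro convexD[OF convex]) (auto simp: divide_simps)
  then show ?thesis using r by simp
qed

lemma minkowski_triangle: "minkowski D (x + y) \<le> minkowski D x + minkowski D y"
proof (rule field_le_epsilon)
  fix e :: real assume e: "0 < e"
  define a b where "a = minkowski D x + e/2" and "b = minkowski D y + e/2"
  have ab: "0 < a" "0 < b" using e minkowski_nonneg[of x] minkowski_nonneg[of y] by (auto simp: a_def b_def)
  have "(1/a) *\<^sub>R x \<in> D" "(1/b) *\<^sub>R y \<in> D"
    using e by (auto intro!: minkowski_less simp: a_def b_def)
  then have "(a/(a+b)) *\<^sub>R ((1/a) *\<^sub>R x) + (b/(a+b)) *\<^sub>R ((1/b) *\<^sub>R y) \<in> D"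
    using ab by (intro convexD[OF convex]) (auto simp: add_divide_distrib[symmetric])
  then have "(1/(a+b)) *\<^sub>R (x + y) \<in> D" using ab by (simp add: scaleR_add_right)
  then have "minkowski D (x + y) \<le> a + b" using ab by (intro minkowski_le) auto
  then show "minkowski D (x + y) \<le> minkowski D x + minkowski D y + e"
    by (simp add: a_def b_def)
qed

lemma minkowski_minus: "minkowski D (- x) = minkowski D x"
proof -
  have "(1/s) *\<^sub>R (- x) \<in> D \<longleftrightarrow> (1/s) *\<^sub>R x \<in> D" for s
    using sym[of "(1/s) *\<^sub>R x"] sym[of "(1/s) *\<^sub>R (- x)"] by auto
  then show ?thesis by (simp add: minkowski_def)
qed

lemma minkowski_scale_le:
  assumes "0 < c"
  shows "minkowski D (c *\<^sub>R x) \<le> c * minkowski D x"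
proof -
  have "minkowski D (c *\<^sub>R x) / c \<le> minkowski D x"
  proof (rule field_le_epsilon)
    fix e :: real assume e: "0 < e"
    define a where "a = minkowski D x + e"
    have a: "0 < a" "(1/a) *\<^sub>R x \<in> D"
      using e minkowski_nonneg[of x] by (auto intro!: minkowski_less simp: a_def)
    then have "minkowski D (c *\<^sub>R x) \<le> c * a" using assms by (intro minkowski_le) auto
    then show "minkowski D (c *\<^sub>R x) / c \<le> minkowski D x + e"
      using assms by (simp add: a_def field_simps)
  qed
  then show ?thesis using assms by (simp add: field_simps)
qed

lemma minkowski_scale: "minkowski D (c *\<^sub>R x) = \<bar>c\<bar> * minkowski D x"
proof -
  have pos: "minkowski D (c *\<^sub>R x) = c * minkowski D x" if "0 < c" for c
  proof (rule antisym[OF minkowski_scale_le[OF that]])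
    have "minkowski D ((1/c) *\<^sub>R (c *\<^sub>R x)) \<le> (1/c) * minkowski D (c *\<^sub>R x)"
      using that by (intro minkowski_scale_le) simp
    then show "c * minkowski D x \<le> minkowski D (c *\<^sub>R x)"
      using that by (simp add: field_simps)
  qed
  have zero: "minkowski D 0 = 0"
    using minkowski_le_norm[of 0] minkowski_nonneg[of 0] by simp
  consider "0 < c" | "c = 0" | "0 < - c" by linarith
  then show ?thesis
  proof cases
    case 3
    from pos[OF this] show ?thesis using 3 by (simp add: minkowski_minus)
  qed (use pos zero in auto)
qed

lemma equivalent_norm_minkowski: "equivalent_norm (minkowski D)"
proof -
  have "minkowski D x = 0 \<longleftrightarrow> x = 0" for x
    using norm_le_minkowski[of x] minkowski_scale[of 0 0] by auto
  then have "is_norm (minkowski D)"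
    unfolding is_norm_def using minkowski_triangle minkowski_scale by blast
  moreover have "(1/R) * norm x \<le> minkowski D x \<and> minkowski D x \<le> 1 * norm x" for x
    using norm_le_minkowski[of x] minkowski_le_norm[of x] R_pos by (simp add: field_simps)
  ultimately show ?thesis
    unfolding equivalent_norm_def using R_pos by (metis zero_less_one zero_less_divide_1_iff)
qed

end

section \<open>Norm bounds for sums of successive moves\<close>

text \<open>
  One player repeatedly names a finite-codimensional subspace, the other adds to the position a
  vector of it.  The first player keeps the position as a sum of blocks, one for each binary digit
  of the number of moves made, with a block of level \<open>j\<close> having norm at most \<open>l ^ j\<close> and consisting
  of \<open>2 ^ j\<close> moves.  A new move has to lie in \<open>E\<close> of every block, so that two blocks
  of the same level can be merged into one of the next level, like carries in a binary counter.
\<close>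

locale merging =
  fixes l :: real and E :: "'a::real_normed_vector \<Rightarrow> 'a set"
  assumes l: "1 \<le> l" "l < 2"
    and E_cof: "E x \<in> cof"
    and E_bound: "norm x \<le> 1 \<Longrightarrow> y \<in> E x \<Longrightarrow> norm y \<le> 1 \<Longrightarrow> norm (x + y) \<le> l"
begin

text \<open>The lowest level comes first, since new moves enter at level 0. A block \<open>w\<close>
  of level \<open>i\<close> is divided by \<open>l ^ i\<close> to bring it into the unit ball, where
  \<open>E_bound\<close> applies.\<close>

fun blocks :: "(nat \<times> 'a) list \<Rightarrow> bool" where
  "blocks [] = True"
| "blocks ((j, z) # zs) \<longleftrightarrow> blocks zs \<and> norm z \<le> l ^ j \<and>
     (\<forall>(i, w)\<in>set zs. j < i \<and> z \<in> E ((1 / l ^ i) *\<^sub>R w))"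

text \<open>The second component counts moves. A block need not be exhibited as a sum of moves: only
  its norm and its membership in the sets \<open>E\<close> are recorded, and level \<open>j\<close>
  is credited with \<open>2 ^ j\<close> moves.\<close>

definition reach :: "('a \<times> real) set" where
  "reach = {(\<Sum>(j, z)\<leftarrow>zs. z, \<Sum>(j, z)\<leftarrow>zs. 2 ^ j) | zs. blocks zs}"

lemma merge:
  assumes "norm w \<le> l ^ i" "norm y \<le> l ^ i" "y \<in> E ((1 / l ^ i) *\<^sub>R w)"
  shows "norm (w + y) \<le> l ^ Suc i"
proof -
  have p: "0 < l ^ i" using l by simp
  have "(1 / l ^ i) *\<^sub>R y \<in> E ((1 / l ^ i) *\<^sub>R w)"
    using assms cof_subspace[OF E_cof] by (simp add: subspace_scale)
  then have "norm ((1 / l ^ i) *\<^sub>R w + (1 / l ^ i) *\<^sub>R y) \<le> l"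
    using assms p by (intro E_bound) auto
  then have "norm ((1 / l ^ i) *\<^sub>R (w + y)) \<le> l" by (simp only: scaleR_add_right)
  then show ?thesis using p by (simp add: pos_divide_le_eq mult.commute)
qed

text \<open>This is the carry: a vector of the same level as the head \<open>w\<close> is merged
  with it, and the sum is passed on one level higher. The sum still satisfies the conditions of the
  remaining blocks because \<open>w\<close> and \<open>y\<close> both do and each \<open>E\<close>
  is a subspace. A vector of lower level becomes the new head.\<close>

lemma blocks_add:
  assumes "blocks zs" "norm y \<le> l ^ j"
    "\<forall>(i, w)\<in>set zs. j \<le> i \<and> y \<in> E ((1 / l ^ i) *\<^sub>R w)"
  shows "\<exists>zs'. blocks zs' \<and> (\<Sum>(j, z)\<leftarrow>zs'. z) = (\<Sum>(j, z)\<leftarrow>zs. z) + y \<and>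
    (\<Sum>(j, z)\<leftarrow>zs'. 2 ^ j) = (\<Sum>(j, z)\<leftarrow>zs. 2 ^ j) + (2 ^ j :: real)"
  using assms
proof (induction zs arbitrary: j y)
  case Nil
  then show ?case by (intro exI[of _ "[(j, y)]"]) auto
next
  case (Cons p zs)
  obtain i w where p: "p = (i, w)" by force
  show ?case
  proof (cases "j = i")
    case True
    have "\<forall>(i', w')\<in>set zs. Suc i \<le> i' \<and> w + y \<in> E ((1 / l ^ i') *\<^sub>R w')"
      using Cons.prems cof_subspace[OF E_cof] by (fastforce simp: p intro: subspace_add)
    moreover have "norm (w + y) \<le> l ^ Suc i"
      using Cons.prems True by (intro merge) (auto simp: p)
    moreover have "blocks zs" using Cons.prems by (simp add: p)
    ultimately obtain zs' where "blocks zs'" "(\<Sum>(j, z)\<leftarrow>zs'. z) = (\<Sum>(j, z)\<leftarrow>zs. z) + (w + y)"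
      "(\<Sum>(j, z)\<leftarrow>zs'. 2 ^ j) = (\<Sum>(j, z)\<leftarrow>zs. 2 ^ j) + (2 ^ Suc i :: real)"
      using Cons.IH by blast
    then show ?thesis using True by (intro exI[of _ zs']) (auto simp: p algebra_simps)
  next
    case False
    then show ?thesis using Cons.prems
      by (intro exI[of _ "(j, y) # p # zs"]) (auto simp: p algebra_simps)
  qed
qed

lemma reach_0: "(0, 0) \<in> reach"
  unfolding reach_def by (auto intro!: exI[of _ "[]"])

lemma reach_step:
  assumes "(x, n) \<in> reach"
  shows "\<exists>Y\<in>cof. \<forall>y\<in>Y. norm y \<le> 1 \<longrightarrow> (x + y, n + 1) \<in> reach"
proof -
  obtain zs where zs: "blocks zs" "x = (\<Sum>(j, z)\<leftarrow>zs. z)" "n = (\<Sum>(j, z)\<leftarrow>zs. 2 ^ j)"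
    using assms unfolding reach_def by blast
  define Y where "Y = (\<Inter>(i, w)\<in>set zs. E ((1 / l ^ i) *\<^sub>R w))"
  have "Y \<in> cof" unfolding Y_def by (rule cof_INT) (auto intro: E_cof)
  moreover have "(x + y, n + 1) \<in> reach" if y: "y \<in> Y" "norm y \<le> 1" for y
  proof -
    have "\<forall>(i, w)\<in>set zs. 0 \<le> i \<and> y \<in> E ((1 / l ^ i) *\<^sub>R w)"
      using y by (auto simp: Y_def)
    with blocks_add[OF zs(1), of y 0] y obtain zs' where "blocks zs'"
      "(\<Sum>(j, z)\<leftarrow>zs'. z) = x + y" "(\<Sum>(j, z)\<leftarrow>zs'. 2 ^ j) = n + 1"
      unfolding zs by auto
    then show ?thesis unfolding reach_def by force
  qed
  ultimately show ?thesis by blast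
qed

text \<open>Levels are distinct, so those below \<open>k\<close> contribute at most the sum of
  \<open>2 ^ j\<close> over \<open>j < k\<close>. From level \<open>k\<close> on,
  \<open>l ^ j = (l / 2) ^ j * 2 ^ j \<le> (l / 2) ^ k * 2 ^ j\<close>, and the \<open>2 ^ j\<close>
  add up to at most \<open>n\<close>. The parameter \<open>k\<close> stays free so that it can be
  matched to the scale of the moves.\<close>

lemma norm_reach_le:
  assumes "(x, n) \<in> reach"
  shows "norm x \<le> 2 ^ k + (l / 2) ^ k * n"
proof -
  obtain zs where zs: "blocks zs" "x = (\<Sum>(j, z)\<leftarrow>zs. z)" "n = (\<Sum>(j, z)\<leftarrow>zs. 2 ^ j)"
    using assms unfolding reach_def by blast
  have level: "l ^ j \<le> (if j < k then 2 ^ j else 0) + (l / 2) ^ k * 2 ^ j" for j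
  proof (cases "j < k")
    case True
    have "l ^ j \<le> 2 ^ j" using l by (intro power_mono) auto
    moreover have "0 \<le> (l / 2) ^ k * 2 ^ j" using l by simp
    ultimately show ?thesis using True by simp
  next
    case False
    have "(l / 2) ^ j \<le> (l / 2) ^ k" using l False by (intro power_decreasing) auto
    then have "(l / 2) ^ j * 2 ^ j \<le> (l / 2) ^ k * 2 ^ j" by (intro mult_right_mono) auto
    then show ?thesis using False by (simp add: power_divide)
  qed
  have dist: "blocks zs \<Longrightarrow> distinct (map fst zs)" for zs
    by (induction zs rule: blocks.induct) fastforce+
  have "blocks zs \<Longrightarrow> norm (\<Sum>(j, z)\<leftarrow>zs. z) \<le>
    (\<Sum>j\<leftarrow>map fst zs. if j < k then 2 ^ j else 0) + (l / 2) ^ k * (\<Sum>(j, z)\<leftarrow>zs. 2 ^ j)" for zs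
  proof (induction zs rule: blocks.induct)
    case 1
    then show ?case by simp
  next
    case (2 j z zs)
    let ?s = "\<Sum>(j, z)\<leftarrow>zs. z"
    have "norm (z + ?s) \<le> norm z + norm ?s" by (rule norm_triangle_ineq)
    moreover have "norm z \<le> (if j < k then 2 ^ j else 0) + (l / 2) ^ k * 2 ^ j"
      using 2 level[of j] by simp
    moreover have "norm ?s \<le> (\<Sum>j\<leftarrow>map fst zs. if j < k then 2 ^ j else 0)
        + (l / 2) ^ k * (\<Sum>(j, z)\<leftarrow>zs. 2 ^ j)"
      using 2 by simp
    ultimately show ?case by (simp add: algebra_simps del: map_map)
  qed
  from this[OF zs(1)] have "norm x \<le>
    (\<Sum>j\<leftarrow>map fst zs. if j < k then 2 ^ j else 0) + (l / 2) ^ k * n" by (simp add: zs)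
  moreover have "(\<Sum>j\<leftarrow>map fst zs. if j < k then 2 ^ j else 0) =
      (\<Sum>j\<in>set (map fst zs). if j < k then 2 ^ j else (0::real))"
    using dist[OF zs(1)] by (rule sum_list_distinct_conv_sum_set)
  moreover have "\<dots> = (\<Sum>j\<in>set (map fst zs) \<inter> {..<k}. 2 ^ j)"
    by (subst sum.inter_restrict) auto
  moreover have "\<dots> \<le> (\<Sum>j<k. (2::real) ^ j)" by (intro sum_mono2) auto
  moreover have "(\<Sum>j<k. (2::real) ^ j) \<le> 2 ^ k"
    using power_diff_1_eq[of "2::real" k] by simp
  ultimately show ?thesis by linarith
qed

section \<open>Moves of all sizes and their prices\<close>

text \<open>
  The moves of size about \<open>4 ^ -k\<close> are collected in a separate, rescaled copy of \<open>reach\<close>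
  for each \<open>k\<close>, at the price \<open>(l / 8) ^ k = o(4 ^ -k)\<close> per move; the choice of the ratio \<open>4\<close>
  makes the errors \<open>4 ^ -k * 2 ^ k\<close> in \<open>norm_reach_le\<close> summable.
\<close>

definition priced :: "('a \<times> real) set" where
  "priced = {(u + (\<Sum>k<m. (1/4) ^ k *\<^sub>R x k), norm u + (\<Sum>k<m. (l / 8) ^ k * n k)) | u m x n.
     \<forall>k. (x k, n k) \<in> reach}"

text \<open>The free summand \<open>u\<close>, priced at its own norm, is what later puts the unit
  ball inside the new ball.\<close>

lemma priced_norm: "(u, norm u) \<in> priced"
proof -
  have "\<forall>k::nat. (0, 0) \<in> reach" using reach_0 by simp
  then show ?thesis
    unfolding priced_def
    by (intro CollectI exI[of _ u] exI[of _ 0] exI[of _ "\<lambda>_. 0"]) simp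
qed

text \<open>With \<open>norm_reach_le\<close> taken at the same \<open>k\<close>, scale
  \<open>k\<close> contributes at most \<open>(1/4) ^ k * 2 ^ k = (1/2) ^ k\<close> plus exactly its
  price, as \<open>1/4 * (l / 2) = l / 8\<close>. The first terms sum to at most 2.\<close>

lemma priced_le:
  assumes "(x, c) \<in> priced"
  shows "norm x \<le> c + 2"
proof -
  obtain u m y n where x: "x = u + (\<Sum>k<m. (1/4) ^ k *\<^sub>R y k)"
    and c: "c = norm u + (\<Sum>k<m. (l / 8) ^ k * n k)"
    and r: "\<And>k. (y k, n k) \<in> reach"
    using assms unfolding priced_def by blast
  have "norm x \<le> norm u + (\<Sum>k<m. norm ((1/4) ^ k *\<^sub>R y k))"
    unfolding x by (rule norm_triangle_le) (intro add_left_mono norm_sum)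
  also have "(\<Sum>k<m. norm ((1/4) ^ k *\<^sub>R y k)) \<le> (\<Sum>k<m. (1/2) ^ k + (l / 8) ^ k * n k)"
  proof (rule sum_mono)
    fix k
    have "norm ((1/4) ^ k *\<^sub>R y k) \<le> (1/4) ^ k * (2 ^ k + (l / 2) ^ k * n k)"
      using norm_reach_le[OF r[of k], of k] by (simp add: mult_left_mono)
    also have "\<dots> = (1/4 * 2) ^ k + (1/4 * (l / 2)) ^ k * n k"
      unfolding power_mult_distrib by (simp add: algebra_simps)
    also have "\<dots> = (1/2) ^ k + (l / 8) ^ k * n k" by simp
    finally show "norm ((1/4) ^ k *\<^sub>R y k) \<le> (1/2) ^ k + (l / 8) ^ k * n k" .
  qed
  also have "\<dots> = (\<Sum>k<m. (1/2) ^ k) + (\<Sum>k<m. (l / 8) ^ k * n k)" by (rule sum.distrib)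
  also have "(\<Sum>k<m. (1/2) ^ k) \<le> (2::real)"
    by (simp add: sum_gp_strict)
  finally show ?thesis by (simp add: c)
qed

lemma priced_step:
  assumes "(x, c) \<in> priced"
  shows "\<exists>Y\<in>cof. \<forall>y\<in>Y. norm y \<le> (1/4) ^ k \<longrightarrow> (x + y, c + (l / 8) ^ k) \<in> priced"
proof -
  obtain u m x' n' where x': "x = u + (\<Sum>k<m. (1/4) ^ k *\<^sub>R x' k)"
    and c': "c = norm u + (\<Sum>k<m. (l / 8) ^ k * n' k)"
    and r': "\<And>k. (x' k, n' k) \<in> reach"
    using assms unfolding priced_def by blast
  \<comment> \<open>Scale \<open>k\<close> may not occur among the first \<open>m\<close>, so the
    representation is padded by \<open>(0, 0) \<in> reach\<close> until it does. This changes
    neither position nor price.\<close>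
  define M where "M = max m (Suc k)"
  define v where "v = (\<lambda>i. if i < m then x' i else 0)"
  define n where "n = (\<lambda>i. if i < m then n' i else 0)"
  have x: "x = u + (\<Sum>k<M. (1/4) ^ k *\<^sub>R v k)"
    unfolding x' v_def M_def add_left_cancel by (rule sum.mono_neutral_cong_left) auto
  have c: "c = norm u + (\<Sum>k<M. (l / 8) ^ k * n k)"
    unfolding c' n_def M_def add_left_cancel by (rule sum.mono_neutral_cong_left) auto
  have r: "(v i, n i) \<in> reach" for i using r' reach_0 by (simp add: v_def n_def)
  have k: "k \<in> {..<M}" by (simp add: M_def)
  obtain Y where Y: "Y \<in> cof" "\<And>y. y \<in> Y \<Longrightarrow> norm y \<le> 1 \<Longrightarrow> (v k + y, n k + 1) \<in> reach"
    using reach_step[OF r[of k]] by blast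
  have "(x + y, c + (l / 8) ^ k) \<in> priced" if y: "y \<in> Y" "norm y \<le> (1/4) ^ k" for y
  proof -
    \<comment> \<open>In the copy of \<open>reach\<close> at scale \<open>k\<close>, the move
      \<open>y\<close> appears magnified by \<open>4 ^ k\<close> and has norm at most 1.\<close>
    let ?v = "v(k := v k + 4 ^ k *\<^sub>R y)" and ?n = "n(k := n k + 1)"
    have "norm (4 ^ k *\<^sub>R y) \<le> 1" using y by (simp add: field_simps)
    then have "(v k + 4 ^ k *\<^sub>R y, n k + 1) \<in> reach"
      using y cof_subspace[OF Y(1)] by (intro Y) (auto intro: subspace_scale)
    then have "\<forall>i. (?v i, ?n i) \<in> reach" using r by simp
    then have "(u + (\<Sum>k<M. (1/4) ^ k *\<^sub>R ?v k), norm u + (\<Sum>k<M. (l / 8) ^ k * ?n k)) \<in> priced"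
      unfolding priced_def by blast
    moreover have "(\<Sum>i<M. (1/4) ^ i *\<^sub>R ?v i) = (\<Sum>i<M. (1/4) ^ i *\<^sub>R v i) + y"
      by (simp add: sum.remove[OF finite_lessThan k] scaleR_add_right power_one_over)
    moreover have "(\<Sum>i<M. (l / 8) ^ i * ?n i) = (\<Sum>i<M. (l / 8) ^ i * n i) + (l / 8) ^ k"
      by (simp add: sum.remove[OF finite_lessThan k] algebra_simps)
    ultimately show ?thesis by (simp add: x c add.assoc)
  qed
  then show ?thesis using Y by blast
qed

section \<open>Convex combinations of priced positions\<close>

lemma hull_priced_le:
  assumes "(x, c) \<in> convex hull priced"
  shows "norm x \<le> c + 2"
proof -
  have "convex hull priced \<subseteq> {p. norm (fst p) \<le> snd p + 2}"
  proof (rule hull_minimal)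
    show "priced \<subseteq> {p. norm (fst p) \<le> snd p + 2}" using priced_le by auto
    show "convex {p :: 'a \<times> real. norm (fst p) \<le> snd p + 2}"
    proof (rule convexI, clarsimp)
      fix x y :: 'a and c d s t :: real
      assume h: "norm x \<le> c + 2" "norm y \<le> d + 2" "0 \<le> s" "0 \<le> t" "s + t = 1"
      have "norm (s *\<^sub>R x + t *\<^sub>R y) \<le> s * norm x + t * norm y"
        using h norm_triangle_ineq[of "s *\<^sub>R x" "t *\<^sub>R y"] by simp
      also have "\<dots> \<le> s * (c + 2) + t * (d + 2)"
        using h by (intro add_mono mult_left_mono) auto
      also have "\<dots> = s * c + t * d + 2 * (s + t)" by (simp add: algebra_simps)
      finally show "norm (s *\<^sub>R x + t *\<^sub>R y) \<le> s * c + t * d + 2" using h by simp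
    qed
  qed
  then show ?thesis using assms by auto
qed

text \<open>The pairs that admit such a subspace form a convex set: for a convex combination the
  intersection of two subspaces serves, since the same increment \<open>(y, (l / 8) ^ k)\<close> is
  added to both pairs and the weights sum to 1.\<close>

lemma hull_priced_step:
  assumes "(x, c) \<in> convex hull priced"
  shows "\<exists>Y\<in>cof. \<forall>y\<in>Y. norm y \<le> (1/4) ^ k \<longrightarrow>
    (x + y, c + (l / 8) ^ k) \<in> convex hull priced"
proof -
  let ?H = "convex hull priced"
  define P where "P = {p. \<exists>Y\<in>cof. \<forall>y\<in>Y. norm y \<le> (1/4) ^ k \<longrightarrow> p + (y, (l / 8) ^ k) \<in> ?H}"
  have "?H \<subseteq> P"
  proof (rule hull_minimal)
    show "priced \<subseteq> P"
    proof clarify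
      fix x c assume "(x, c) \<in> priced"
      from priced_step[OF this, of k] obtain Y where "Y \<in> cof"
        "\<And>y. y \<in> Y \<Longrightarrow> norm y \<le> (1/4) ^ k \<Longrightarrow> (x + y, c + (l / 8) ^ k) \<in> priced" by blast
      then show "(x, c) \<in> P" by (auto simp: P_def intro!: bexI[of _ Y] hull_inc)
    qed
    show "convex P"
    proof (rule convexI)
      fix p q :: "'a \<times> real" and s t :: real
      assume st: "0 \<le> s" "0 \<le> t" "s + t = 1" and "p \<in> P" "q \<in> P"
      then obtain Y Z where
        Y: "Y \<in> cof" "\<And>y. y \<in> Y \<Longrightarrow> norm y \<le> (1/4) ^ k \<Longrightarrow> p + (y, (l / 8) ^ k) \<in> ?H" and
        Z: "Z \<in> cof" "\<And>y. y \<in> Z \<Longrightarrow> norm y \<le> (1/4) ^ k \<Longrightarrow> q + (y, (l / 8) ^ k) \<in> ?H"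
        unfolding P_def by blast
      have "s *\<^sub>R p + t *\<^sub>R q + (y, (l / 8) ^ k) \<in> ?H"
        if y: "y \<in> Y \<inter> Z" "norm y \<le> (1/4) ^ k" for y
      proof -
        let ?e = "(y, (l / 8) ^ k)"
        have "s *\<^sub>R (p + ?e) + t *\<^sub>R (q + ?e) \<in> ?H"
          using y Y Z st by (intro convexD[OF convex_convex_hull]) auto
        also have "s *\<^sub>R (p + ?e) + t *\<^sub>R (q + ?e) = s *\<^sub>R p + t *\<^sub>R q + (s + t) *\<^sub>R ?e"
          by (simp add: scaleR_add_right scaleR_add_left del: scaleR_Pair)
        finally show ?thesis using st by simp
      qed
      then show "s *\<^sub>R p + t *\<^sub>R q \<in> P"
        unfolding P_def using cof_Int[OF Y(1) Z(1)] by blast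
    qed
  qed
  then have "(x, c) \<in> P" using assms by blast
  then show ?thesis unfolding P_def by simp
qed

section \<open>The new unit ball\<close>

definition sublevel :: "'a set" where
  "sublevel = {x. \<exists>c\<le>1. (x, c) \<in> convex hull priced}"

text \<open>The choice of \<open>E\<close> is arbitrary, so \<open>sublevel\<close> need not be
  symmetric. Intersecting with the reflection keeps convexity, and moves from \<open>x\<close> and
  from \<open>- x\<close> can be controlled together.\<close>

definition new_ball :: "'a set" where
  "new_ball = sublevel \<inter> uminus ` sublevel"

lemma mem_new_ball: "x \<in> new_ball \<longleftrightarrow> x \<in> sublevel \<and> - x \<in> sublevel"
  unfolding new_ball_def by (metis IntD1 IntD2 IntI image_iff minus_minus)

lemma convex_sublevel: "convex sublevel"
proof (rule convexI)
  fix x y and s t :: real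
  assume st: "0 \<le> s" "0 \<le> t" "s + t = 1" and "x \<in> sublevel" "y \<in> sublevel"
  then obtain c d where c: "c \<le> 1" "(x, c) \<in> convex hull priced"
    and d: "d \<le> 1" "(y, d) \<in> convex hull priced" by (auto simp: sublevel_def)
  have "s *\<^sub>R (x, c) + t *\<^sub>R (y, d) \<in> convex hull priced"
    using st c d by (intro convexD[OF convex_convex_hull]) auto
  moreover have "s * c + t * d \<le> s * 1 + t * 1"
    using st c d by (intro add_mono mult_left_mono) auto
  ultimately show "s *\<^sub>R x + t *\<^sub>R y \<in> sublevel"
    unfolding sublevel_def using st by (auto intro!: exI[of _ "s * c + t * d"])
qed

text \<open>The radius 3 is the price bound 1 plus the constant 2 of
  \<open>hull_priced_le\<close>.\<close>

sublocale new_ball: convex_body new_ball 3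
proof
  show "convex new_ball"
    unfolding new_ball_def by (intro convex_Int convex_sublevel convex_negations)
  show "- x \<in> new_ball" if "x \<in> new_ball" for x
    using that by (simp add: mem_new_ball)
  have "x \<in> sublevel" if "norm x \<le> 1" for x
    unfolding sublevel_def using that priced_norm[of x] hull_subset[of priced convex] by blast
  then show "x \<in> new_ball" if "norm x \<le> 1" for x
    using that by (simp add: mem_new_ball)
  show "norm x \<le> 3" if "x \<in> new_ball" for x
    using that hull_priced_le by (force simp: mem_new_ball sublevel_def)
qed simp

text \<open>A move raises the price to at most \<open>1 + (l / 8) ^ k\<close>. A convex combination
  with the free position \<open>(0, 0)\<close> scales position and price together and brings the
  price back to at most 1.\<close>

lemma sublevel_step:
  assumes "x \<in> sublevel"
  shows "\<exists>Y\<in>cof. \<forall>y\<in>Y. norm y \<le> (1/4) ^ k \<longrightarrow> (1 / (1 + (l / 8) ^ k)) *\<^sub>R (x + y) \<in> sublevel"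
proof -
  let ?\<kappa> = "(l / 8) ^ k" and ?H = "convex hull priced"
  have \<kappa>: "0 < ?\<kappa>" using l by simp
  obtain c where c: "c \<le> 1" "(x, c) \<in> ?H" using assms by (auto simp: sublevel_def)
  have "(0, 0) \<in> ?H" using priced_norm[of 0] hull_subset[of priced convex] by auto
  have "(1 / (1 + ?\<kappa>)) *\<^sub>R (x + y) \<in> sublevel" if "(x + y, c + ?\<kappa>) \<in> ?H" for y
  proof -
    have "(1 / (1 + ?\<kappa>)) *\<^sub>R (x + y, c + ?\<kappa>) + (?\<kappa> / (1 + ?\<kappa>)) *\<^sub>R (0, 0) \<in> ?H"
      using that \<open>(0, 0) \<in> ?H\<close> \<kappa>
      by (intro convexD[OF convex_convex_hull]) (auto simp: add_divide_distrib[symmetric])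
    moreover have "(c + ?\<kappa>) / (1 + ?\<kappa>) \<le> 1" using c \<kappa> by simp
    ultimately show ?thesis unfolding sublevel_def by auto
  qed
  then show ?thesis using hull_priced_step[OF c(2), of k] by blast
qed

lemma new_ball_step:
  assumes "x \<in> new_ball"
  shows "\<exists>Y\<in>cof. \<forall>y\<in>Y. norm y \<le> (1/4) ^ k \<longrightarrow>
    minkowski new_ball (x + y) \<le> 1 + (l / 8) ^ k"
proof -
  let ?\<kappa> = "(l / 8) ^ k"
  have \<kappa>: "0 < ?\<kappa>" using l by simp
  obtain Y where Y: "Y \<in> cof"
    "\<And>y. y \<in> Y \<Longrightarrow> norm y \<le> (1/4) ^ k \<Longrightarrow> (1 / (1 + ?\<kappa>)) *\<^sub>R (x + y) \<in> sublevel"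
    using assms sublevel_step[of x k] mem_new_ball by blast
  obtain Z where Z: "Z \<in> cof"
    "\<And>y. y \<in> Z \<Longrightarrow> norm y \<le> (1/4) ^ k \<Longrightarrow> (1 / (1 + ?\<kappa>)) *\<^sub>R (- x + y) \<in> sublevel"
    using assms sublevel_step[of "- x" k] mem_new_ball by blast
  have "minkowski new_ball (x + y) \<le> 1 + ?\<kappa>" if y: "y \<in> Y \<inter> Z" "norm y \<le> (1/4) ^ k" for y
  proof -
    \<comment> \<open>Moving from \<open>x\<close> by \<open>y\<close> means moving from
      \<open>- x\<close> by \<open>- y\<close>, which is again in the subspace
      \<open>Z\<close>.\<close>
    have "(1 / (1 + ?\<kappa>)) *\<^sub>R (- x + - y) \<in> sublevel"
      using y cof_subspace[OF Z(1)] by (intro Z) (auto intro: subspace_neg)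
    moreover have "- ((1 / (1 + ?\<kappa>)) *\<^sub>R (x + y)) = (1 / (1 + ?\<kappa>)) *\<^sub>R (- x + - y)"
      by (simp add: algebra_simps)
    ultimately have "(1 / (1 + ?\<kappa>)) *\<^sub>R (x + y) \<in> new_ball"
      using Y y by (simp add: mem_new_ball)
    then show ?thesis using \<kappa> by (intro new_ball.minkowski_le) auto
  qed
  then show ?thesis using cof_Int[OF Y(1) Z(1)] by blast
qed

text \<open>The factor 3 in the hypothesis on \<open>t\<close> is the radius of
  \<open>new_ball\<close>: it bounds \<open>norm y\<close> for a unit vector \<open>y\<close> of the
  new norm. The factor 3 in the conclusion comes from
  \<open>(1 + \<kappa>) * (1 + \<kappa>) \<le> 1 + 3 * \<kappa>\<close> for
  \<open>\<kappa> = (l / 8) ^ k \<le> 1\<close>.\<close>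

lemma minkowski_new_ball_step:
  assumes x: "minkowski new_ball x = 1" and t: "0 < t" "3 * t \<le> (1/4) ^ k"
  shows "\<exists>Y\<in>cof. \<forall>y\<in>Y. minkowski new_ball y = 1 \<longrightarrow>
    minkowski new_ball (x + t *\<^sub>R y) \<le> 1 + 3 * (l / 8) ^ k"
proof -
  let ?\<kappa> = "(l / 8) ^ k" and ?N = "minkowski new_ball"
  have \<kappa>: "0 < ?\<kappa>" "?\<kappa> \<le> 1" using l by (auto intro: power_le_one)
  \<comment> \<open>A vector of new norm 1 may lie outside \<open>new_ball\<close>, so it is first
    divided by some \<open>s > 1\<close>. Taking the same \<open>s\<close> as in
    \<open>new_ball_step\<close> costs only a second factor \<open>s\<close>.\<close>
  define s where "s = 1 + ?\<kappa>"
  have s: "1 < s" using \<kappa> by (simp add: s_def)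
  have "(1/s) *\<^sub>R x \<in> new_ball" using x s by (intro new_ball.minkowski_less) simp
  from new_ball_step[OF this, of k] obtain Y where Y: "Y \<in> cof"
    "\<And>y. y \<in> Y \<Longrightarrow> norm y \<le> (1/4) ^ k \<Longrightarrow> ?N ((1/s) *\<^sub>R x + y) \<le> s" unfolding s_def by blast
  have "?N (x + t *\<^sub>R y) \<le> 1 + 3 * ?\<kappa>" if y: "y \<in> Y" "?N y = 1" for y
  proof -
    have "norm y \<le> 3" using new_ball.norm_le_minkowski[of y] y by simp
    then have "t * norm y / s \<le> t * 3 / 1" using s t by (intro frac_le mult_left_mono) auto
    then have "norm ((t/s) *\<^sub>R y) \<le> (1/4) ^ k" using s t by simp
    then have "?N ((1/s) *\<^sub>R x + (t/s) *\<^sub>R y) \<le> s"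
      using y cof_subspace[OF Y(1)] by (intro Y) (auto intro: subspace_scale)
    then have "s * ?N ((1/s) *\<^sub>R x + (t/s) *\<^sub>R y) \<le> s * s" using s by simp
    moreover have "s * ?N ((1/s) *\<^sub>R x + (t/s) *\<^sub>R y) = ?N (s *\<^sub>R ((1/s) *\<^sub>R x + (t/s) *\<^sub>R y))"
      using s by (simp add: new_ball.minkowski_scale)
    moreover have "s *\<^sub>R ((1/s) *\<^sub>R x + (t/s) *\<^sub>R y) = x + t *\<^sub>R y"
      using s by (simp add: scaleR_add_right)
    moreover have "s * s \<le> 1 + 3 * ?\<kappa>"
    proof -
      have "?\<kappa> * ?\<kappa> \<le> ?\<kappa> * 1" using \<kappa> by (intro mult_left_mono) auto
      then show ?thesis by (simp add: s_def algebra_simps)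
    qed
    ultimately show ?thesis by simp
  qed
  then show ?thesis using Y by blast
qed

lemma aus_modulus_new_ball_le:
  assumes t: "0 < t" "3 * t \<le> (1/4) ^ k"
  shows "aus_modulus (minkowski new_ball) t \<le> ereal (3 * (l / 8) ^ k)"
  unfolding aus_modulus_def
proof (rule SUP_least)
  fix x assume "x \<in> {x. minkowski new_ball x = 1}"
  with minkowski_new_ball_step[OF _ t, of x] obtain Y where Y: "Y \<in> cof"
    "\<And>y. y \<in> Y \<Longrightarrow> minkowski new_ball y = 1 \<Longrightarrow>
      minkowski new_ball (x + t *\<^sub>R y) \<le> 1 + 3 * (l / 8) ^ k" by blast
  then show "(INF Y\<in>cof. SUP y\<in>{y \<in> Y. minkowski new_ball y = 1}.
      ereal (minkowski new_ball (x + t *\<^sub>R y) - 1)) \<le> ereal (3 * (l / 8) ^ k)"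
    by (intro INF_lower2[OF Y(1)] SUP_least) force
qed

end

section \<open>Asymptotic uniform smoothness of the new norm\<close>

text \<open>In infinite dimension every member of \<open>cof\<close> contains a unit vector
  \<open>y\<close>. A unit vector \<open>x\<close> is the midpoint of
  \<open>x + t *\<^sub>R y\<close> and \<open>x - t *\<^sub>R y\<close>, so one of these has norm at
  least 1.\<close>

lemma aus_modulus_nonneg:
  fixes N :: "'a::real_normed_vector \<Rightarrow> real"
  assumes N: "is_norm N" and inf: "\<nexists>F::'a set. finite F \<and> span F = UNIV"
  shows "0 \<le> aus_modulus N t"
proof -
  have N0: "N x = 0 \<longleftrightarrow> x = 0" and tri: "N (x + y) \<le> N x + N y" and
    sc: "N (c *\<^sub>R x) = \<bar>c\<bar> * N x" for x y c
    using N by (auto simp: is_norm_def)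
  have nn: "0 \<le> N x" for x using tri[of x "- x"] sc[of "-1" x] N0[of 0] by simp
  have ex: "\<exists>y\<in>Y. N y = 1" if Y: "Y \<in> cof" for Y
  proof -
    obtain F where F: "finite F" "span (Y \<union> F) = UNIV" "subspace Y"
      using Y by (auto simp: cof_def)
    have "\<not> Y \<subseteq> {0}"
    proof
      assume "Y \<subseteq> {0}"
      then have "span (Y \<union> F) \<subseteq> span (insert 0 F)" by (intro span_mono) auto
      with F inf show False by auto
    qed
    then obtain z where z: "z \<in> Y" "z \<noteq> 0" by blast
    have "N ((1 / N z) *\<^sub>R z) = 1" using z N0 sc nn[of z] by simp
    then show ?thesis using z F by (meson subspace_scale)
  qed
  obtain x where x: "N x = 1" using ex[OF cof_UNIV] by blast
  have "0 \<le> (SUP y\<in>{y \<in> Y. N y = 1}. ereal (N (x + t *\<^sub>R y) - 1))" if Y: "Y \<in> cof" for Y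
  proof -
    obtain y where y: "y \<in> Y" "N y = 1" using ex[OF Y] by blast
    have y': "- y \<in> Y" "N (- y) = 1"
      using y cof_subspace[OF Y] sc[of "-1" y] by (auto intro: subspace_neg)
    have "N (2 *\<^sub>R x) \<le> N (x + t *\<^sub>R y) + N (x + t *\<^sub>R (- y))"
      using tri[of "x + t *\<^sub>R y" "x + t *\<^sub>R (- y)"] by (simp add: scaleR_2)
    then have "1 \<le> N (x + t *\<^sub>R y) \<or> 1 \<le> N (x + t *\<^sub>R (- y))" using sc[of 2 x] x by linarith
    then obtain w where "w \<in> Y" "N w = 1" "1 \<le> N (x + t *\<^sub>R w)" using y y' by blast
    then show ?thesis by (intro SUP_upper2[of w]) auto
  qed
  then show ?thesis
    unfolding aus_modulus_def using x by (intro SUP_upper2[of x, OF _ INF_greatest]) auto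
qed

context merging
begin

text \<open>If \<open>(1/4) ^ Suc k < 3 * t \<le> (1/4) ^ k\<close>, the modulus at \<open>t\<close>
  is at most \<open>3 * (l / 8) ^ k\<close>, and dividing by \<open>t\<close> leaves at most
  \<open>36 * (l / 2) ^ k\<close>. This tends to 0 because \<open>l < 2\<close>.\<close>

lemma aus_minkowski_new_ball: "asymp_uniformly_smooth (minkowski new_ball)"
proof (cases "\<exists>F::'a set. finite F \<and> span F = UNIV")
  case True
  then show ?thesis by (simp add: asymp_uniformly_smooth_def)
next
  case False
  let ?\<rho> = "aus_modulus (minkowski new_ball)"
  have lower: "0 \<le> ?\<rho> t" for t
    using new_ball.equivalent_norm_minkowski False
    by (intro aus_modulus_nonneg) (auto simp: equivalent_norm_def)
  have ev: "\<forall>\<^sub>F t in at_right 0. ?\<rho> t / ereal t < ereal e" if e: "0 < e" for e :: real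
  proof -
    \<comment> \<open>Here 36 is the product of the 3 in the bound on the modulus, the 3 in
      \<open>3 * t\<close>, and the ratio 4 of consecutive scales.\<close>
    have "(\<lambda>k. 36 * (l / 2) ^ k) \<longlonglongrightarrow> 36 * 0"
      using l by (intro tendsto_mult tendsto_const LIMSEQ_realpow_zero) auto
    then have "\<forall>\<^sub>F k in sequentially. 36 * (l / 2) ^ k < e"
      using e by (intro order_tendstoD) auto
    then obtain K where K: "\<And>k. k \<ge> K \<Longrightarrow> 36 * (l / 2) ^ k < e"
      by (auto simp: eventually_sequentially)
    have "?\<rho> t / ereal t < ereal e" if t: "0 < t" "t < (1/4) ^ K / 3" for t
    proof -
      have "\<exists>k. (1/4) ^ k < 3 * t" using t by (intro real_arch_pow_inv) auto
      \<comment> \<open>Minimality of \<open>m\<close> places \<open>3 * t\<close> between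
        consecutive powers of \<open>1/4\<close>. Once \<open>m > K\<close> is known, the
        predecessor \<open>k\<close> exists and is at least \<open>K\<close>.\<close>
      define m where "m = (LEAST k. (1/4) ^ k < 3 * t)"
      have m: "(1/4) ^ m < 3 * t" unfolding m_def by (rule LeastI_ex) fact
      have "m > K"
      proof (rule ccontr)
        assume "\<not> m > K"
        then have "(1/4::real) ^ K \<le> (1/4) ^ m" by (intro power_decreasing) auto
        then show False using m t by linarith
      qed
      then obtain k where k: "m = Suc k" "k \<ge> K" by (cases m) auto
      have "\<not> (1/4) ^ k < 3 * t" using not_less_Least[of k "\<lambda>k. (1/4) ^ k < 3 * t"] k
        unfolding m_def by simp
      then have "?\<rho> t \<le> ereal (3 * (l / 8) ^ k)" using t by (intro aus_modulus_new_ball_le) auto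
      then have "?\<rho> t / ereal t \<le> ereal (3 * (l / 8) ^ k) / ereal t"
        using t by (intro ereal_divide_right_mono) auto
      also have "\<dots> = ereal (3 * (l / 8) ^ k / t)" using t by simp
      also have "3 * (l / 8) ^ k / t < e"
      proof -
        have "3 * (l / 8) ^ k = 36 * (l / 2) ^ k * ((1/4) ^ Suc k / 3)"
          by (simp add: power_divide flip: power_mult_distrib)
        also have "\<dots> \<le> 36 * (l / 2) ^ k * t"
          using m k l by (intro mult_left_mono) auto
        also have "\<dots> < e * t" using K[OF k(2)] t by simp
        finally show ?thesis using t by (simp add: pos_divide_less_eq)
      qed
      finally show ?thesis by simp
    qed
    then show ?thesis
      unfolding eventually_at_right_field by (intro exI[of _ "(1/4) ^ K / 3"]) auto
  qed
  have "((\<lambda>t. ?\<rho> t / ereal t) \<longlongrightarrow> 0) (at_right 0)"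
  proof (rule order_tendstoI)
    fix a :: ereal assume a: "a < 0"
    have "\<forall>\<^sub>F t in at_right (0::real). 0 < t" by (rule eventually_at_right_less)
    then show "\<forall>\<^sub>F t in at_right 0. a < ?\<rho> t / ereal t"
    proof eventually_elim
      case (elim t)
      then have "0 \<le> ?\<rho> t / ereal t" using lower[of t] by (intro zero_le_divide_ereal) auto
      then show ?case using a by (rule less_le_trans[rotated])
    qed
  next
    fix a :: ereal assume "0 < a"
    then obtain e where e: "0 < ereal e" "ereal e < a" using ereal_dense2 by blast
    from ev[of e] e show "\<forall>\<^sub>F t in at_right 0. ?\<rho> t / ereal t < a"
      by (auto elim: eventually_mono)
  qed
  then show ?thesis by (simp add: asymp_uniformly_smooth_def)
qed

end

theorem theorem3p1:
  assumes "\<exists>t0. 0 < t0 \<and> t0 < 1 \<and> 0 < beta_modulus (norm :: 'a::banach \<Rightarrow> real) t0"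
  shows "\<exists>N :: 'a \<Rightarrow> real. equivalent_norm N \<and> asymp_uniformly_smooth N"
proof -
  obtain l where l: "1 \<le> l" "l < 2" and
    "\<forall>x::'a. norm x \<le> 1 \<longrightarrow> (\<exists>Y\<in>cof. \<forall>y\<in>Y. norm y \<le> 1 \<longrightarrow> norm (x + y) \<le> l)"
    using assms beta_modulus_imp_asymptotic_bound by blast
  \<comment> \<open>Outside the unit ball \<open>UNIV\<close> serves as default, so that
    \<open>E\<close> takes values in \<open>cof\<close> everywhere.\<close>
  then have "\<forall>x::'a. \<exists>Y\<in>cof. norm x \<le> 1 \<longrightarrow> (\<forall>y\<in>Y. norm y \<le> 1 \<longrightarrow> norm (x + y) \<le> l)"
    using cof_UNIV by blast
  then obtain E :: "'a \<Rightarrow> 'a set" where "\<forall>x. E x \<in> cof \<and>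
      (norm x \<le> 1 \<longrightarrow> (\<forall>y\<in>E x. norm y \<le> 1 \<longrightarrow> norm (x + y) \<le> l))"
    by metis
  with l interpret merging l E by unfold_locales auto
  show ?thesis
    using new_ball.equivalent_norm_minkowski aus_minkowski_new_ball by blast
qed

end
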